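(* Let $\lambda^{\text{in}},\lambda^{\text{out}}>0$, let $\hat T$ be one of the reference triangles $\hat T^{(1)},\hat T^{(2)}$, and let $\mathcal P_{\hat T,h}[\lambda^{\text{out}},\lambda^{\text{in}}]\in\mathbb R^{2\times2}$ and $\mathbf\Gamma_{\hat T,h}[\lambda^{\text{out}}]\in\mathbb R^{2\times 2}$ be the matrices defined in the context (computed with the same mesh and the same finite element space, the mesh resolving $\hat T$ by exactly one element). Then $$\mathcal P_{\hat T,h}[\lambda^{\text{out}},\lambda^{\text{in}}]=(\lambda^{\text{in}}-\lambda^{\text{out}})\,\mathbf\Gamma_{\hat T,h}[\lambda^{\text{out}}]\left(\mathbf I_2-(\lambda^{\text{in}}-\lambda^{\text{out}})\mathbf\Gamma_{\hat T,h}[\lambda^{\text{out}}]\right)^{-1}$$ and further $$\mathbf I_2+\mathcal P_{\hat T,h}[\lambda^{\text{out}},\lambda^{\text{in}}]=\left(\mathbf I_2-(\lambda^{\text{in}}-\lambda^{\text{out}})\mathbf\Gamma_{\hat T,h}[\lambda^{\text{out}}]\right)^{-1}.$$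
   Context: Reference triangles: $\hat T^{(1)}$ is the open triangle with vertices $\frac13(-2,-1)^\top,\frac13(1,-1)^\top,\frac13(1,2)^\top$; $\hat T^{(2)}$ is the open triangle with vertices $\frac13(2,1)^\top,\frac13(-1,-2)^\top,\frac13(-1,1)^\top$. Truncated domain and finite element space: $B_R(0)\subset\mathbb R^2$ denotes the truncated domain of radius $R$ (understood as the polygonal domain covered by the mesh), containing the closure of $\hat T$. Let $\{\tau_1,\dots,\tau_M\}$ be a conforming triangular mesh of $B_R(0)$ such that $\hat T$ is exactly one element of this mesh. Let $$V_h^R=\{v\in C^0(\overline{B_R(0)}): v|_{\partial B_R(0)}=0,\ v|_{\tau_i}\text{ affine linear for } i=1,\dots,M\}.$$ Let $\mathbf e^{(1)},\mathbf e^{(2)}$ be the Cartesian unit vectors of $\mathbb R^2$, $\mathbf I_2$ the $2\times2$ identity matrix, and $\lambda_{\hat T}(x)=\chi_{\hat T}(x)\lambda^{\text{in}}+\chi_{B_R(0)\setminus\hat T}(x)\lambda^{\text{out}}$. Discrete correctors: for $k=1,2$, $K_k:=K_{\hat T,h}[\lambda^{\text{out}},\lambda^{\text{in}};\mathbf e^{(k)}]\in V_h^R$ is the unique solution of $$\int_{B_R(0)}\lambda_{\hat T}\nabla K_k\cdot\nabla\psi_h\,dx=-(\lambda^{\text{in}}-\lambda^{\text{out}})\int_{\hat T}\mathbf e^{(k)}\cdot\nabla\psi_h\,dx\quad\forall\psi_h\in V_h^R,$$ and $W_k:=W_{\hat T,h}[\lambda^{\text{out}};\mathbf e^{(k)}]\in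 V_h^R$ is the unique solution of $$\int_{B_R(0)}\lambda^{\text{out}}\nabla W_k\cdot\nabla\psi_h\,dx=-\int_{\hat T}\mathbf e^{(k)}\cdot\nabla\psi_h\,dx\quad\forall\psi_h\in V_h^R.$$ Matrices: (given by their two columns) $$\mathcal P_{\hat T,h}[\lambda^{\text{out}},\lambda^{\text{in}}]=\left[\frac1{|\hat T|}\int_{\hat T}\nabla K_1\,dx\quad\frac1{|\hat T|}\int_{\hat T}\nabla K_2\,dx\right],\qquad \mathbf\Gamma_{\hat T,h}[\lambda^{\text{out}}]=\left[\frac1{|\hat T|}\int_{\hat T}\nabla W_1\,dx\quad\frac1{|\hat T|}\int_{\hat T}\nabla W_2\,dx\right].$$ *)

theory Defs
  imports "HOL-Analysis.Analysis"
begin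

definition ref_triangle1 :: "(real^2) set" where
  "ref_triangle1 = interior (convex hull
     {(1/3) *\<^sub>R vector [-2, -1], (1/3) *\<^sub>R vector [1, -1], (1/3) *\<^sub>R vector [1, 2]})"

definition ref_triangle2 :: "(real^2) set" where
  "ref_triangle2 = interior (convex hull
     {(1/3) *\<^sub>R vector [2, 1], (1/3) *\<^sub>R vector [-1, -2], (1/3) *\<^sub>R vector [-1, 1]})"

text \<open>Mesh elements are open triangles. The library's \<open>triangulation\<close>, applied to
  their closures, contains the conformity condition: the intersection of any two closed elements
  is a common face (empty, a vertex, an edge, or the whole triangle if they coincide).\<close>

definition conforming_mesh :: "(real^2) set set \<Rightarrow> bool" where
  "conforming_mesh M \<longleftrightarrow>
     finite M \<and>
     (\<forall>T\<in>M. \<exists>S. 2 simplex S \<and> T = interior S) \<and>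
     triangulation (closure ` M)"

text \<open>The polygonal domain covered by the mesh; it plays the role of the truncated domain
  \<open>B\<^sub>R(0)\<close>.\<close>

definition mesh_domain :: "(real^2) set set \<Rightarrow> (real^2) set" where
  "mesh_domain M = interior (\<Union>T\<in>M. closure T)"

text \<open>Elements of the finite element space are functions on the closure of the domain. HOL
  functions being total, they are represented by their extension by zero, so that two of them are
  equal iff they agree on the closure.\<close>

definition fe_space :: "(real^2) set set \<Rightarrow> (real^2 \<Rightarrow> real) set" where
  "fe_space M = {v.
     continuous_on (closure (mesh_domain M)) v \<and>
     (\<forall>x\<in>frontier (mesh_domain M). v x = 0) \<and>
     (\<forall>T\<in>M. \<exists>a b. \<forall>x\<in>T. v x = a \<bullet> x + b) \<and>
     (\<forall>x. x \<notin> closure (mesh_domain M) \<longrightarrow> v x = 0)}"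

text \<open>The classical gradient. A finite element function has it in every (open) mesh element,
  where it agrees with the weak gradient; the values on the edges, a null set, are irrelevant to
  the integrals below.\<close>

definition grad :: "(real^2 \<Rightarrow> real) \<Rightarrow> real^2 \<Rightarrow> real^2" where
  "grad v x = (THE D. GDERIV v x :> D)"

definition coeff :: "(real^2) set set \<Rightarrow> (real^2) set \<Rightarrow> real \<Rightarrow> real \<Rightarrow> real^2 \<Rightarrow> real" where
  "coeff M T lout lin x =
     indicator T x * lin + indicator (mesh_domain M - T) x * lout"

definition corrector_K ::
  "(real^2) set set \<Rightarrow> (real^2) set \<Rightarrow> real \<Rightarrow> real \<Rightarrow> real^2 \<Rightarrow> (real^2 \<Rightarrow> real)" where
  "corrector_K M T lout lin e = (THE K. K \<in> fe_space M \<and>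
     (\<forall>\<psi>\<in>fe_space M.
        (LINT x:mesh_domain M|lebesgue. coeff M T lout lin x * (grad K x \<bullet> grad \<psi> x))
        = - (lin - lout) * (LINT x:T|lebesgue. e \<bullet> grad \<psi> x)))"

definition corrector_W ::
  "(real^2) set set \<Rightarrow> (real^2) set \<Rightarrow> real \<Rightarrow> real^2 \<Rightarrow> (real^2 \<Rightarrow> real)" where
  "corrector_W M T lout e = (THE W. W \<in> fe_space M \<and>
     (\<forall>\<psi>\<in>fe_space M.
        (LINT x:mesh_domain M|lebesgue. lout * (grad W x \<bullet> grad \<psi> x))
        = - (LINT x:T|lebesgue. e \<bullet> grad \<psi> x)))"

definition average_grad :: "(real^2) set \<Rightarrow> (real^2 \<Rightarrow> real) \<Rightarrow> real^2" where
  "average_grad T v = (1 / measure lebesgue T) *\<^sub>R (LINT x:T|lebesgue. grad v x)"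

text \<open>The \<open>k\<close>-th column is the averaged gradient of the corrector for the \<open>k\<close>-th unit vector;
  \<open>A $ i $ k\<close> is the entry in row \<open>i\<close> and column \<open>k\<close>.\<close>

definition P_matrix ::
  "(real^2) set set \<Rightarrow> (real^2) set \<Rightarrow> real \<Rightarrow> real \<Rightarrow> real^2^2" where
  "P_matrix M T lout lin =
     (\<chi> i k. average_grad T (corrector_K M T lout lin (axis k 1)) $ i)"

definition Gamma_matrix :: "(real^2) set set \<Rightarrow> (real^2) set \<Rightarrow> real \<Rightarrow> real^2^2" where
  "Gamma_matrix M T lout =
     (\<chi> i k. average_grad T (corrector_W M T lout (axis k 1)) $ i)"

end

theory Submission
  imports Defs
begin

text \<open>Splitting the coefficient as \<open>lout + (lin - lout) \<chi>\<^sub>T\<close> and moving the second summand to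
  the right-hand side turns the equation for \<open>K\<close> into the constant-coefficient equation with the
  datum \<open>e\<close> replaced by \<open>e\<close> plus the (constant) gradient of \<open>K\<close> on \<open>T\<close>. By unique solvability
  and linearity, \<open>P = (lin - lout) \<Gamma> (I + P)\<close>, that is
  \<open>(I - (lin - lout) \<Gamma>) (I + P) = I\<close>.\<close>

section \<open>Variational problems on finite-dimensional function spaces\<close>

text \<open>The finite set \<open>F\<close> of separating functionals expresses that \<open>V\<close> is finite-dimensional. In
  the induction, one functional is removed by passing to its kernel, whose \<open>a\<close>-orthogonal
  complement in \<open>V\<close> is at most a line.\<close>

lemma variational_problem_solvable:
  fixes V :: "('a \<Rightarrow> real) set" and a :: "('a \<Rightarrow> real) \<Rightarrow> ('a \<Rightarrow> real) \<Rightarrow> real"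
  assumes "finite F"
    and "\<And>f u v c. f \<in> F \<Longrightarrow> u \<in> V \<Longrightarrow> v \<in> V \<Longrightarrow> f (\<lambda>x. u x + c * v x) = f u + c * f v"
    and "\<And>u. u \<in> V \<Longrightarrow> (\<And>f. f \<in> F \<Longrightarrow> f u = 0) \<Longrightarrow> u = (\<lambda>_. 0)"
    and "(\<lambda>_. 0) \<in> V"
    and "\<And>u v c. u \<in> V \<Longrightarrow> v \<in> V \<Longrightarrow> (\<lambda>x. u x + c * v x) \<in> V"
    and "\<And>u v w c. u \<in> V \<Longrightarrow> v \<in> V \<Longrightarrow> w \<in> V \<Longrightarrow> a (\<lambda>x. u x + c * v x) w = a u w + c * a v w"
    and "\<And>u v. u \<in> V \<Longrightarrow> v \<in> V \<Longrightarrow> a u v = a v u"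
    and "\<And>u. u \<in> V \<Longrightarrow> a u u = 0 \<Longrightarrow> u = (\<lambda>_. 0)"
    and "\<And>u v c. u \<in> V \<Longrightarrow> v \<in> V \<Longrightarrow> l (\<lambda>x. u x + c * v x) = l u + c * l v"
  shows "\<exists>u\<in>V. \<forall>\<psi>\<in>V. a u \<psi> = l \<psi>"
  using assms
proof (induction F arbitrary: V l rule: finite_induct)
  case empty
  note lin_a = empty.prems(5) and lin_l = empty.prems(8)
  have V: "u = (\<lambda>_. 0)" if "u \<in> V" for u using empty.prems(2) that by blast
  have "a (\<lambda>_. 0) (\<lambda>_. 0) = 0"
    using lin_a[of "\<lambda>_. 0" "\<lambda>_. 0" "\<lambda>_. 0" 1] empty.prems(3) by simp
  moreover have "l (\<lambda>_. 0) = 0"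
    using lin_l[of "\<lambda>_. 0" "\<lambda>_. 0" 1] empty.prems(3) by simp
  ultimately show ?case using V empty.prems(3) by metis
next
  case (insert f F)
  note F_lin = insert.prems(1) and sep = insert.prems(2) and zero = insert.prems(3)
    and comb = insert.prems(4) and lin_a = insert.prems(5) and sym_a = insert.prems(6)
    and def_a = insert.prems(7) and lin_l = insert.prems(8)
  \<comment> \<open>On the kernel of \<open>f\<close> the functionals in \<open>F\<close> alone
    still separate, so the induction hypothesis applies to \<open>V'\<close>.\<close>
  define V' where "V' = {u \<in> V. f u = 0}"
  have V'D: "u \<in> V" "f u = 0" if "u \<in> V'" for u using that by (auto simp: V'_def)
  have f0: "f (\<lambda>_. 0) = 0"
    using F_lin[of f "\<lambda>_. 0" "\<lambda>_. 0" 1] zero by simp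
  have lin_a2: "a w (\<lambda>x. u x + c * v x) = a w u + c * a w v"
    if "u \<in> V" "v \<in> V" "w \<in> V" for u v w c
    using that lin_a[of u v w c] sym_a comb by simp
  \<comment> \<open>The right-hand side \<open>m\<close> stays arbitrary because two instances are
    needed: \<open>l\<close>, and \<open>a b\<close> for the projection of \<open>b\<close> onto
    \<open>V'\<close>.\<close>
  have IH: "\<exists>u\<in>V'. \<forall>\<psi>\<in>V'. a u \<psi> = m \<psi>"
    if m: "\<And>u v c. u \<in> V \<Longrightarrow> v \<in> V \<Longrightarrow> m (\<lambda>x. u x + c * v x) = m u + c * m v" for m
  proof (rule insert.IH)
    show "u = (\<lambda>_. 0)" if "u \<in> V'" "\<And>g. g \<in> F \<Longrightarrow> g u = 0" for u
      using sep[of u] that V'D by auto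
    show "(\<lambda>_. 0) \<in> V'" using f0 zero by (simp add: V'_def)
    show "(\<lambda>x. u x + c * v x) \<in> V'" if "u \<in> V'" "v \<in> V'" for u v c
      using that F_lin[of f u v c] comb by (simp add: V'_def)
  qed (use V'D F_lin lin_a sym_a def_a m in auto)
  obtain u where u: "u \<in> V'" "\<And>\<psi>. \<psi> \<in> V' \<Longrightarrow> a u \<psi> = l \<psi>" using IH[of l] lin_l by blast
  show ?case
  proof (cases "V \<subseteq> V'")
    case True
    then show ?thesis using u V'D by blast
  next
    case False
    then obtain b where b: "b \<in> V" "f b \<noteq> 0" by (auto simp: V'_def)
    obtain p where p: "p \<in> V'" "\<And>\<psi>. \<psi> \<in> V' \<Longrightarrow> a p \<psi> = a b \<psi>"
      using IH[of "a b"] lin_a2 b(1) by blast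
    \<comment> \<open>Subtracting the projection \<open>p\<close> makes \<open>c\<close> orthogonal
      to \<open>V'\<close>, while \<open>f c = f b\<close> stays nonzero; hence \<open>c\<close>
      spans the complement.\<close>
    define c where "c = (\<lambda>x. b x + (-1) * p x)"
    have c: "c \<in> V" unfolding c_def using b p V'D comb by blast
    have fc: "f c \<noteq> 0"
      unfolding c_def using F_lin[of f b p "-1"] b p V'D by simp
    have orth: "a c \<psi> = 0" if "\<psi> \<in> V'" for \<psi>
      unfolding c_def using lin_a[of b p \<psi> "-1"] b p V'D that by simp
    have ac: "a c c \<noteq> 0" using def_a[OF c] fc f0 by auto
    \<comment> \<open>The added multiple of \<open>c\<close> is invisible to tests in
      \<open>V'\<close>; its factor is chosen so that testing with \<open>c\<close> gives
      \<open>l c\<close>.\<close>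
    define U where "U = (\<lambda>x. u x + l c / a c c * c x)"
    have "a U \<psi> = l \<psi>" if \<psi>: "\<psi> \<in> V" for \<psi>
    proof -
      \<comment> \<open>This is the multiple of \<open>c\<close> whose removal from the test
        function leaves a remainder in the kernel of \<open>f\<close>.\<close>
      define t where "t = f \<psi> / f c"
      define r where "r = (\<lambda>x. \<psi> x + (- t) * c x)"
      have r: "r \<in> V'"
        using comb[OF \<psi> c, of "- t"] F_lin[of f \<psi> c "-t"] \<psi> c fc by (simp add: V'_def r_def t_def)
      have \<psi>_eq: "\<psi> = (\<lambda>x. r x + t * c x)" by (simp add: r_def)
      have "a u c = 0" using orth[OF u(1)] sym_a u(1) V'D c by simp
      then have "a u \<psi> = l r"
        unfolding \<psi>_eq using lin_a2[of r c u t] u r V'D c by simp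
      moreover have "a c \<psi> = t * a c c"
        unfolding \<psi>_eq using lin_a2[of r c c t] orth[OF r] r V'D c by simp
      moreover have "l \<psi> = l r + t * l c"
        using lin_l[of r c t] r V'D c unfolding \<psi>_eq by simp
      moreover have "a U \<psi> = a u \<psi> + l c / a c c * a c \<psi>"
        unfolding U_def using lin_a[of u c \<psi> "l c / a c c"] u V'D c \<psi> by simp
      ultimately show ?thesis using ac by simp
    qed
    moreover have "U \<in> V" unfolding U_def using comb u V'D c by blast
    ultimately show ?thesis by blast
  qed
qed

text \<open>Testing with the difference of the two solutions and using definiteness gives
  equality.\<close>

lemma variational_problem_unique:
  fixes V :: "('a \<Rightarrow> real) set" and a :: "('a \<Rightarrow> real) \<Rightarrow> ('a \<Rightarrow> real) \<Rightarrow> real"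
  assumes comb: "\<And>u v c. u \<in> V \<Longrightarrow> v \<in> V \<Longrightarrow> (\<lambda>x. u x + c * v x) \<in> V"
    and lin: "\<And>u v w c. u \<in> V \<Longrightarrow> v \<in> V \<Longrightarrow> w \<in> V \<Longrightarrow>
      a (\<lambda>x. u x + c * v x) w = a u w + c * a v w"
    and defi: "\<And>u. u \<in> V \<Longrightarrow> a u u = 0 \<Longrightarrow> u = (\<lambda>_. 0)"
    and u: "u \<in> V" and v: "v \<in> V" and eq: "\<And>\<psi>. \<psi> \<in> V \<Longrightarrow> a u \<psi> = a v \<psi>"
  shows "u = v"
proof -
  define w where "w = (\<lambda>x. u x + (-1) * v x)"
  have w: "w \<in> V" unfolding w_def by (intro comb u v)
  have "a w w = a u w + (-1) * a v w" using lin[OF u v w, of "-1"] by (simp add: w_def)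
  then have "w = (\<lambda>_. 0)" using eq[OF w] defi[OF w] by simp
  then show ?thesis by (auto simp: w_def fun_eq_iff)
qed

section \<open>Finite element functions\<close>

text \<open>Since \<open>grad\<close> is a definite description, the proof needs both a derivative,
  obtained locally on the open set, and the uniqueness of derivatives.\<close>

lemma grad_affine:
  assumes "open S" "x \<in> S" and v: "\<And>y. y \<in> S \<Longrightarrow> v y = a \<bullet> y + b"
  shows "grad v x = a"
proof -
  have "((\<lambda>y. a \<bullet> y + b) has_derivative (\<lambda>h. h \<bullet> a)) (at x)"
    by (auto intro!: derivative_eq_intros simp: inner_commute)
  then have "(v has_derivative (\<lambda>h. h \<bullet> a)) (at x)"
    by (rule has_derivative_transform_within_open[OF _ assms(1,2)]) (simp add: v)
  then have D: "GDERIV v x :> a" by (simp add: gderiv_def)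
  have "D = a" if "GDERIV v x :> D" for D
  proof -
    have "(\<lambda>h. h \<bullet> D) = (\<lambda>h. h \<bullet> a)"
      using that D unfolding gderiv_def by (rule has_derivative_unique)
    then show ?thesis by (simp add: fun_eq_iff vector_eq_ldot)
  qed
  with D show ?thesis unfolding grad_def by (rule the_equality)
qed

section \<open>Geometry of the mesh and integrals of elementwise constant functions\<close>

context
  fixes M :: "(real^2) set set"
  assumes mesh: "conforming_mesh M"
begin

lemma mesh_finite: "finite M"
  using mesh by (simp add: conforming_mesh_def)

lemma mesh_element:
  assumes "T \<in> M"
  shows open_element: "open T" and convex_element: "convex T"
    and bounded_element: "bounded T" and element_nonempty: "T \<noteq> {}"
proof -
  obtain S where S: "2 simplex S" "T = interior S"
    using mesh assms by (auto simp: conforming_mesh_def)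
  show "open T" "convex T" using S convex_simplex by (auto simp: convex_interior)
  show "bounded T"
    using S compact_simplex compact_imp_bounded bounded_interior by blast
  \<comment> \<open>A 2-simplex has full dimension in the plane, so its interior is its relative
    interior, which is nonempty by convexity.\<close>
  have "aff_dim S = int (DIM(real^2))" using aff_dim_simplex[OF S(1)] by simp
  then have "affine hull S = UNIV" using aff_dim_eq_full by blast
  then have "rel_interior S = interior S" by (rule rel_interior_interior)
  moreover have "S \<noteq> {}" using S(1) by auto
  ultimately show "T \<noteq> {}"
    using S rel_interior_eq_empty convex_simplex by metis
qed

lemma element_lmeasurable: "T \<in> M \<Longrightarrow> T \<in> lmeasurable"
  using mesh_element by (simp add: lmeasurable_open)

lemma measure_element_pos:
  assumes "T \<in> M"
  shows "measure lebesgue T > 0"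
proof -
  have "\<not> negligible T" using open_not_negligible mesh_element[OF assms] by blast
  then show ?thesis
    using negligible_iff_measure0[OF element_lmeasurable[OF assms]] measure_nonneg[of lebesgue T]
    by linarith
qed

lemma element_subset_domain: "T \<in> M \<Longrightarrow> T \<subseteq> mesh_domain M"
  unfolding mesh_domain_def
  by (rule interior_maximal) (use closure_subset open_element in auto)

lemma closure_domain_subset: "closure (mesh_domain M) \<subseteq> closure (\<Union>M)"
proof (rule closure_minimal)
  show "mesh_domain M \<subseteq> closure (\<Union>M)"
    unfolding mesh_domain_def using interior_subset closure_mono[of _ "\<Union>M"] by blast
qed simp

lemma bounded_domain: "bounded (mesh_domain M)"
proof -
  have "bounded (\<Union>M)" using mesh_finite bounded_element by (auto intro: bounded_Union)
  then show ?thesis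
    using closure_domain_subset closure_subset bounded_closure bounded_subset by metis
qed

text \<open>A domain point in no open element lies on the frontier of one, and frontiers of convex
  sets are null. Integrals over the domain therefore see only the open elements.\<close>

lemma negligible_domain_diff: "negligible (mesh_domain M - \<Union>M)"
proof (rule negligible_subset)
  show "negligible (\<Union>T\<in>M. frontier T)"
    using mesh_finite convex_element negligible_convex_frontier by (auto intro: negligible_Union)
  show "mesh_domain M - \<Union>M \<subseteq> (\<Union>T\<in>M. frontier T)"
  proof
    fix x assume x: "x \<in> mesh_domain M - \<Union>M"
    then obtain T where T: "T \<in> M" "x \<in> closure T"
      using interior_subset unfolding mesh_domain_def by blast
    then have "x \<notin> interior T" using x interior_subset by blast
    then show "x \<in> (\<Union>T\<in>M. frontier T)" using T by (auto simp: frontier_def)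
  qed
qed

lemma set_integrable_element:
  fixes f :: "real^2 \<Rightarrow> 'b::euclidean_space"
  assumes T: "T \<in> M" and f: "\<And>x. x \<in> T \<Longrightarrow> f x = c"
  shows "set_integrable lebesgue T f" and "(LINT x:T|lebesgue. f x) = measure lebesgue T *\<^sub>R c"
proof -
  have meas: "T \<in> sets lebesgue" "emeasure lebesgue T < \<infinity>"
    using element_lmeasurable[OF T] by (auto simp: fmeasurable_def)
  have "set_integrable lebesgue T (\<lambda>_. c)"
    unfolding set_integrable_def by (intro integrable_indicator meas)
  then show "set_integrable lebesgue T f"
    using f set_integrable_cong[of lebesgue lebesgue T T f "\<lambda>_. c"] by auto
  have "(LINT x:T|lebesgue. f x) = (LINT x:T|lebesgue. c)"
    using f meas by (intro set_lebesgue_integral_cong) auto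
  also have "\<dots> = measure lebesgue T *\<^sub>R c"
    using meas by (simp add: set_lebesgue_integral_def)
  finally show "(LINT x:T|lebesgue. f x) = measure lebesgue T *\<^sub>R c" .
qed

text \<open>Integrability holds on the finite union of open elements; the remaining null set carries
  over whatever values \<open>f\<close> has on the edges.\<close>

lemma set_integrable_domain:
  fixes f :: "real^2 \<Rightarrow> real"
  assumes "\<And>T. T \<in> M \<Longrightarrow> \<exists>c. \<forall>x\<in>T. f x = c"
  shows "set_integrable lebesgue (mesh_domain M) f"
proof -
  have "set_integrable lebesgue (\<Union>T\<in>M. T) f"
  proof (rule set_integrable_UN[OF mesh_finite])
    fix T assume T: "T \<in> M"
    then obtain c where "\<forall>x\<in>T. f x = c" using assms by blast
    then show "set_integrable lebesgue T f" using set_integrable_element(1)[OF T] by blast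
    show "T \<in> sets lebesgue" using element_lmeasurable[OF T] by blast
  qed
  then have "f absolutely_integrable_on \<Union>M" by simp
  then show ?thesis
  proof (rule absolutely_integrable_spike_set)
    show "negligible {x \<in> \<Union> M - mesh_domain M. f x \<noteq> 0}"
      using element_subset_domain by (intro empty_imp_negligible) blast
    show "negligible {x \<in> mesh_domain M - \<Union> M. f x \<noteq> 0}"
      by (rule negligible_subset[OF negligible_domain_diff]) blast
  qed
qed

text \<open>Agreement is required on open elements only, since \<open>grad\<close> is not controlled
  on the edges.\<close>

lemma set_integral_domain_cong:
  fixes f g :: "real^2 \<Rightarrow> real"
  assumes f: "set_integrable lebesgue (mesh_domain M) f"
    and eq: "\<And>T x. T \<in> M \<Longrightarrow> x \<in> T \<Longrightarrow> g x = f x"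
  shows "(LINT x:mesh_domain M|lebesgue. g x) = (LINT x:mesh_domain M|lebesgue. f x)"
proof -
  have "g absolutely_integrable_on mesh_domain M"
    by (rule absolutely_integrable_spike[OF f negligible_domain_diff]) (use eq in auto)
  moreover have "integral (mesh_domain M) g = integral (mesh_domain M) f"
    by (rule integral_spike[OF negligible_domain_diff]) (use eq in auto)
  ultimately show ?thesis
    using f by (simp add: set_lebesgue_integral_eq_integral(2))
qed

section \<open>Elementwise gradients of finite element functions\<close>

lemma fe_space_affine:
  assumes "v \<in> fe_space M" and "T \<in> M"
  shows "\<exists>a b. \<forall>x\<in>T. v x = a \<bullet> x + b"
  using assms by (simp add: fe_space_def)

text \<open>The gradient is constant on an element and so equals its mean. Hence
  \<open>average_grad T v\<close> serves below as the name of that constant.\<close>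

lemma grad_element:
  assumes v: "v \<in> fe_space M" and T: "T \<in> M" and x: "x \<in> T"
  shows "grad v x = average_grad T v"
proof -
  obtain a b where ab: "\<forall>y\<in>T. v y = a \<bullet> y + b"
    using fe_space_affine[OF v T] by blast
  have g: "grad v y = a" if "y \<in> T" for y by (rule grad_affine[OF open_element[OF T] that ab[rule_format]])
  have "average_grad T v = a"
    using set_integrable_element(2)[OF T g] measure_element_pos[OF T] by (simp add: average_grad_def)
  then show ?thesis using g x by simp
qed

lemma fe_space_zero: "(\<lambda>_. 0) \<in> fe_space M"
  unfolding fe_space_def by (auto intro!: exI[of _ "0::real^2"] exI[of _ "0::real"])

lemma fe_space_comb:
  assumes u: "u \<in> fe_space M" and v: "v \<in> fe_space M"
  shows "(\<lambda>x. u x + c * v x) \<in> fe_space M"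
proof -
  have "\<exists>a b. \<forall>x\<in>T. u x + c * v x = a \<bullet> x + b" if T: "T \<in> M" for T
  proof -
    obtain a b where "\<forall>x\<in>T. u x = a \<bullet> x + b" using fe_space_affine[OF u T] by blast
    moreover obtain a' b' where "\<forall>x\<in>T. v x = a' \<bullet> x + b'"
      using fe_space_affine[OF v T] by blast
    ultimately have "\<forall>x\<in>T. u x + c * v x = (a + c *\<^sub>R a') \<bullet> x + (b + c * b')"
      by (simp add: algebra_simps inner_left_distrib)
    then show ?thesis by blast
  qed
  then show ?thesis
    using u v unfolding fe_space_def by (auto intro!: continuous_intros)
qed

lemma average_grad_comb:
  assumes u: "u \<in> fe_space M" and v: "v \<in> fe_space M" and T: "T \<in> M"
  shows "average_grad T (\<lambda>x. u x + c * v x) = average_grad T u + c *\<^sub>R average_grad T v"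
proof -
  \<comment> \<open>The three gradients are constant on \<open>T\<close>, so comparing them at one
    point suffices.\<close>
  obtain x where x: "x \<in> T" using element_nonempty[OF T] by blast
  obtain a b where u_eq: "\<forall>x\<in>T. u x = a \<bullet> x + b" using fe_space_affine[OF u T] by blast
  obtain a' b' where v_eq: "\<forall>x\<in>T. v x = a' \<bullet> x + b'" using fe_space_affine[OF v T] by blast
  have "grad (\<lambda>x. u x + c * v x) x = a + c *\<^sub>R a'"
    by (rule grad_affine[OF open_element[OF T] x, where b = "b + c * b'"])
      (simp add: u_eq v_eq algebra_simps inner_left_distrib)
  moreover have "grad u x = a" "grad v x = a'"
    using grad_affine[OF open_element[OF T] x u_eq[rule_format]] grad_affine[OF open_element[OF T] x v_eq[rule_format]] by auto
  ultimately show ?thesis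
    using grad_element[OF u T x] grad_element[OF v T x] grad_element[OF fe_space_comb[OF u v] T x]
    by simp
qed

lemma element_integral:
  assumes "v \<in> fe_space M" and "T \<in> M"
  shows "(LINT x:T|lebesgue. e \<bullet> grad v x) = measure lebesgue T * (e \<bullet> average_grad T v)"
  using set_integrable_element(2)[OF assms(2), of "\<lambda>x. e \<bullet> grad v x" "e \<bullet> average_grad T v"]
    grad_element assms by simp

section \<open>The Dirichlet form and functions with vanishing gradient\<close>

definition dirichlet :: "(real^2 \<Rightarrow> real) \<Rightarrow> (real^2 \<Rightarrow> real) \<Rightarrow> real" where
  "dirichlet u v = (LINT x:mesh_domain M|lebesgue. grad u x \<bullet> grad v x)"

lemma dirichlet_integrable:
  assumes "u \<in> fe_space M" and "v \<in> fe_space M"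
  shows "set_integrable lebesgue (mesh_domain M) (\<lambda>x. grad u x \<bullet> grad v x)"
  by (rule set_integrable_domain) (use grad_element assms in auto)

lemma dirichlet_comb:
  assumes u: "u \<in> fe_space M" and v: "v \<in> fe_space M" and w: "w \<in> fe_space M"
  shows "dirichlet (\<lambda>x. u x + c * v x) w = dirichlet u w + c * dirichlet v w"
proof -
  note int = dirichlet_integrable[OF u w] set_integrable_mult_right[OF dirichlet_integrable[OF v w]]
  have "dirichlet (\<lambda>x. u x + c * v x) w
      = (LINT x:mesh_domain M|lebesgue. grad u x \<bullet> grad w x + c * (grad v x \<bullet> grad w x))"
    unfolding dirichlet_def
  proof (rule set_integral_domain_cong)
    show "set_integrable lebesgue (mesh_domain M)
        (\<lambda>x. grad u x \<bullet> grad w x + c * (grad v x \<bullet> grad w x))"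
      by (intro set_integral_add(1) int)
    show "grad (\<lambda>x. u x + c * v x) x \<bullet> grad w x = grad u x \<bullet> grad w x + c * (grad v x \<bullet> grad w x)"
      if "T \<in> M" "x \<in> T" for T x
      using that u v w by (simp add: grad_element[of _ T] fe_space_comb average_grad_comb
          inner_left_distrib)
  qed
  also have "\<dots> = dirichlet u w + c * dirichlet v w"
    unfolding dirichlet_def using int by (simp add: set_integral_add(2))
  finally show ?thesis .
qed

lemma dirichlet_commute: "dirichlet u v = dirichlet v u"
  by (simp add: dirichlet_def inner_commute)

text \<open>The integrand is a square, so restricting the integral to one element can only decrease
  it. This yields definiteness of the energy even for negative \<open>d\<close>.\<close>

lemma dirichlet_ge_element:
  assumes v: "v \<in> fe_space M" and T: "T \<in> M"
  shows "measure lebesgue T * (average_grad T v \<bullet> average_grad T v) \<le> dirichlet v v"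
proof -
  note intD = dirichlet_integrable[OF v v]
  have g: "grad v x \<bullet> grad v x = average_grad T v \<bullet> average_grad T v" if "x \<in> T" for x
    using grad_element[OF v T that] by simp
  have intT: "set_integrable lebesgue T (\<lambda>x. grad v x \<bullet> grad v x)"
    "(LINT x:T|lebesgue. grad v x \<bullet> grad v x)
      = measure lebesgue T *\<^sub>R (average_grad T v \<bullet> average_grad T v)"
    by (rule set_integrable_element[OF T], erule g)+
  have "(LINT x:T|lebesgue. grad v x \<bullet> grad v x) \<le> dirichlet v v"
    unfolding dirichlet_def set_lebesgue_integral_eq_integral(2)[OF intD]
      set_lebesgue_integral_eq_integral(2)[OF intT(1)]
    by (rule integral_subset_le[OF element_subset_domain[OF T]
          set_lebesgue_integral_eq_integral(1)[OF intT(1)]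
          set_lebesgue_integral_eq_integral(1)[OF intD]]) simp
  then show ?thesis using intT(2) by simp
qed

text \<open>A function with vanishing gradient takes finitely many values on the union of the open
  elements, hence on the connected closure of the domain, so it is constant there.\<close>

lemma fe_space_eq_zero:
  assumes v: "v \<in> fe_space M" and conn: "connected (mesh_domain M)" and "M \<noteq> {}"
    and g0: "\<And>T. T \<in> M \<Longrightarrow> average_grad T v = 0"
  shows "v = (\<lambda>_. 0)"
proof -
  let ?C = "closure (mesh_domain M)"
  have cont: "continuous_on ?C v" and bd: "\<And>x. x \<in> frontier (mesh_domain M) \<Longrightarrow> v x = 0"
    and out: "\<And>x. x \<notin> ?C \<Longrightarrow> v x = 0"
    using v unfolding fe_space_def by auto
  have "finite (v ` T)" if T: "T \<in> M" for T
  proof -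
    obtain a b where ab: "\<forall>x\<in>T. v x = a \<bullet> x + b" using fe_space_affine[OF v T] by blast
    obtain x where x: "x \<in> T" using element_nonempty[OF T] by blast
    have "a = 0"
      using grad_affine[OF open_element[OF T] x ab[rule_format]] grad_element[OF v T x] g0[OF T] by simp
    then have "v ` T \<subseteq> {b}" using ab by auto
    then show ?thesis using finite_subset by blast
  qed
  then have fin: "finite (v ` \<Union>M)" using mesh_finite by (simp add: image_Union)
  have C: "closure (\<Union>M) = ?C"
    using closure_domain_subset closure_mono[of "\<Union>M" "mesh_domain M"] element_subset_domain
    by blast
  \<comment> \<open>The finite value set is closed and the open elements are dense in
    \<open>?C\<close>, so continuity yields no new values.\<close>
  have "v ` ?C \<subseteq> v ` \<Union>M"
    using image_closure_subset[of "\<Union>M" v "v ` \<Union>M"] cont fin C by (simp add: finite_imp_closed)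
  then have "v constant_on ?C"
    using conn cont fin by (intro continuous_finite_range_constant connected_imp_connected_closure)
      (auto intro: finite_subset)
  then obtain c where c: "\<And>x. x \<in> ?C \<Longrightarrow> v x = c" unfolding constant_on_def by blast
  \<comment> \<open>A nonempty bounded domain has a frontier point, where the boundary condition
    forces the constant to be 0.\<close>
  have "mesh_domain M \<noteq> {}"
    using \<open>M \<noteq> {}\<close> element_nonempty element_subset_domain by blast
  moreover have "mesh_domain M \<noteq> UNIV" using bounded_domain not_bounded_UNIV by metis
  ultimately obtain y where y: "y \<in> frontier (mesh_domain M)" using frontier_eq_empty by blast
  then have "c = 0" using c bd by (auto simp: frontier_def)
  then have "v x = 0" for x using c out by (cases "x \<in> ?C") auto
  then show ?thesis by (simp add: fun_eq_iff)
qed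

section \<open>The discrete correctors\<close>

text \<open>With \<open>d = 0\<close> this is the bilinear form of \<open>W\<close>, with \<open>d = lin - lout\<close> that of \<open>K\<close>.\<close>

definition energy :: "(real^2) set \<Rightarrow> real \<Rightarrow> real \<Rightarrow> (real^2 \<Rightarrow> real) \<Rightarrow> (real^2 \<Rightarrow> real) \<Rightarrow> real" where
  "energy T lout d u v =
     lout * dirichlet u v + d * (measure lebesgue T * (average_grad T u \<bullet> average_grad T v))"

lemma energy_comb:
  assumes "u \<in> fe_space M" "v \<in> fe_space M" "w \<in> fe_space M" "T \<in> M"
  shows "energy T lout d (\<lambda>x. u x + c * v x) w = energy T lout d u w + c * energy T lout d v w"
  using assms by (simp add: energy_def dirichlet_comb average_grad_comb inner_left_distrib
      algebra_simps)

text \<open>The contribution \<open>B\<close> of \<open>T\<close> satisfies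
  \<open>0 \<le> B \<le> dirichlet v v\<close>. Thus the energy is at least \<open>lout\<close>
  times the Dirichlet energy if \<open>d \<ge> 0\<close>, and at least \<open>lout + d\<close> times
  it otherwise; with \<open>d = lin - lout\<close> the latter factor is \<open>lin\<close>.\<close>

lemma energy_definite:
  assumes v: "v \<in> fe_space M" and T: "T \<in> M" and conn: "connected (mesh_domain M)"
    and pos: "lout > 0" "lout + d > 0" and zero: "energy T lout d v v = 0"
  shows "v = (\<lambda>_. 0)"
proof -
  define B where "B = measure lebesgue T * (average_grad T v \<bullet> average_grad T v)"
  have B: "0 \<le> B" "B \<le> dirichlet v v"
    using dirichlet_ge_element[OF v T] by (auto simp: B_def)
  have E: "lout * dirichlet v v + d * B = 0" using zero by (simp add: energy_def B_def)
  have "dirichlet v v \<le> 0"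
  proof (cases "d \<ge> 0")
    case True
    then have "lout * dirichlet v v \<le> 0"
      using E B(1) mult_nonneg_nonneg[of d B] by linarith
    then show ?thesis using pos(1) by (simp add: mult_le_0_iff)
  next
    case False
    then have "(lout + d) * dirichlet v v \<le> 0"
      using E mult_left_mono_neg[OF B(2), of d] False unfolding distrib_right by linarith
    then show ?thesis using pos(2) by (simp add: mult_le_0_iff)
  qed
  then have "average_grad S v = 0" if S: "S \<in> M" for S
    using dirichlet_ge_element[OF v S] measure_element_pos[OF S]
      mult_pos_pos[of "measure lebesgue S" "average_grad S v \<bullet> average_grad S v"]
    by (metis inner_gt_zero_iff linorder_not_less order.strict_trans1 order.trans)
  then show ?thesis using fe_space_eq_zero[OF v conn] T by blast
qed

lemma energy_unique:
  assumes T: "T \<in> M" and conn: "connected (mesh_domain M)" and pos: "lout > 0" "lout + d > 0"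
    and u: "u \<in> fe_space M" and v: "v \<in> fe_space M"
    and eq: "\<And>\<psi>. \<psi> \<in> fe_space M \<Longrightarrow> energy T lout d u \<psi> = energy T lout d v \<psi>"
  shows "u = v"
proof (rule variational_problem_unique[where V = "fe_space M" and a = "energy T lout d"])
  show "(\<lambda>x. u x + c * v x) \<in> fe_space M" if "u \<in> fe_space M" "v \<in> fe_space M" for u v c
    using that by (rule fe_space_comb)
  show "energy T lout d (\<lambda>x. u x + c * v x) w = energy T lout d u w + c * energy T lout d v w"
    if "u \<in> fe_space M" "v \<in> fe_space M" "w \<in> fe_space M" for u v w c
    using that T by (rule energy_comb)
  show "u = (\<lambda>_. 0)" if "u \<in> fe_space M" "energy T lout d u u = 0" for u
    using energy_definite[OF that(1) T conn pos that(2)] .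
qed (fact u v eq)+

lemma energy_ex1:
  assumes T: "T \<in> M" and conn: "connected (mesh_domain M)"
    and pos: "lout > 0" "lout + d > 0"
    and l: "\<And>u v c. u \<in> fe_space M \<Longrightarrow> v \<in> fe_space M \<Longrightarrow>
      l (\<lambda>x. u x + c * v x) = l u + c * l v"
  shows "\<exists>!u. u \<in> fe_space M \<and> (\<forall>\<psi>\<in>fe_space M. energy T lout d u \<psi> = l \<psi>)"
proof (rule ex_ex1I)
  \<comment> \<open>The components of the elementwise gradients are finitely many linear
    functionals, and they separate because a function with zero gradient vanishes.\<close>
  let ?F = "(\<lambda>(S, i) v. average_grad S v $ i) ` (M \<times> (UNIV :: 2 set))"
  have "\<exists>u\<in>fe_space M. \<forall>\<psi>\<in>fe_space M. energy T lout d u \<psi> = l \<psi>"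
  proof (rule variational_problem_solvable[where F = ?F])
    show "finite ?F" using mesh_finite by simp
    show "f (\<lambda>x. u x + c * v x) = f u + c * f v"
      if "f \<in> ?F" "u \<in> fe_space M" "v \<in> fe_space M" for f u v c
      using that by (auto simp: average_grad_comb)
    show "u = (\<lambda>_. 0)" if u: "u \<in> fe_space M" and 0: "\<And>f. f \<in> ?F \<Longrightarrow> f u = 0" for u
    proof (rule fe_space_eq_zero[OF u conn])
      show "average_grad S u = 0" if "S \<in> M" for S
        using 0[of "\<lambda>v. average_grad S v $ _"] that by (force simp: vec_eq_iff)
    qed (use T in blast)
    show "energy T lout d u v = energy T lout d v u" for u v
      by (simp add: energy_def dirichlet_commute[of u v] inner_commute)
    show "energy T lout d (\<lambda>x. u x + c * v x) w = energy T lout d u w + c * energy T lout d v w"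
      if "u \<in> fe_space M" "v \<in> fe_space M" "w \<in> fe_space M" for u v w c
      using that T by (rule energy_comb)
    show "u = (\<lambda>_. 0)" if "u \<in> fe_space M" "energy T lout d u u = 0" for u
      using energy_definite[OF that(1) T conn pos that(2)] .
  qed (rule fe_space_zero fe_space_comb l; assumption)+
  then show "\<exists>u. u \<in> fe_space M \<and> (\<forall>\<psi>\<in>fe_space M. energy T lout d u \<psi> = l \<psi>)" by blast
next
  fix u v
  assume "u \<in> fe_space M \<and> (\<forall>\<psi>\<in>fe_space M. energy T lout d u \<psi> = l \<psi>)"
    and "v \<in> fe_space M \<and> (\<forall>\<psi>\<in>fe_space M. energy T lout d v \<psi> = l \<psi>)"
  then show "u = v"
    by (intro energy_unique[OF T conn pos]) auto
qed

section \<open>The corrector equations in terms of the energy\<close>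

lemma coeff_integral_eq_energy:
  assumes u: "u \<in> fe_space M" and v: "v \<in> fe_space M" and T: "T \<in> M"
  shows "(LINT x:mesh_domain M|lebesgue. coeff M T lout lin x * (grad u x \<bullet> grad v x))
    = energy T lout (lin - lout) u v"
proof -
  let ?D = "mesh_domain M" and ?f = "\<lambda>x. grad u x \<bullet> grad v x"
  have TD: "T \<subseteq> ?D" by (rule element_subset_domain[OF T])
  have f: "?f x = average_grad T u \<bullet> average_grad T v" if "x \<in> T" for x
    using that u v T by (simp add: grad_element)
  have intT: "set_integrable lebesgue T ?f"
    "(LINT x:T|lebesgue. ?f x) = measure lebesgue T *\<^sub>R (average_grad T u \<bullet> average_grad T v)"
    by (rule set_integrable_element[OF T], erule f)+
  have ind: "indicator ?D x *\<^sub>R (indicator T x * ?f x) = indicator T x *\<^sub>R ?f x" for x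
    using TD by (auto simp: indicator_def)
  have intTD: "set_integrable lebesgue ?D (\<lambda>x. indicator T x * ?f x)"
    using intT(1) unfolding set_integrable_def ind .
  have eqTD: "(LINT x:?D|lebesgue. indicator T x * ?f x) = (LINT x:T|lebesgue. ?f x)"
    unfolding set_lebesgue_integral_def ind ..
  note intD = dirichlet_integrable[OF u v]
  \<comment> \<open>On the domain the coefficient is \<open>lout\<close> plus
    \<open>lin - lout\<close> times the indicator of \<open>T\<close>.\<close>
  have "(LINT x:?D|lebesgue. coeff M T lout lin x * ?f x)
      = (LINT x:?D|lebesgue. lout * ?f x + (lin - lout) * (indicator T x * ?f x))"
    unfolding set_lebesgue_integral_def coeff_def
    by (intro Bochner_Integration.integral_cong) (auto simp: indicator_def algebra_simps)
  also have "\<dots> = lout * (LINT x:?D|lebesgue. ?f x)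
      + (lin - lout) * (LINT x:?D|lebesgue. indicator T x * ?f x)"
    by (subst set_integral_add(2)) (use intD intTD in \<open>auto intro: set_integrable_mult_right\<close>)
  finally show ?thesis
    unfolding eqTD intT(2) by (simp add: energy_def dirichlet_def)
qed

text \<open>Linearity of the load, with a factor \<open>d\<close> so that it covers \<open>K\<close>
  (\<open>d = lin - lout\<close>) and \<open>W\<close> (\<open>d = 1\<close>).\<close>

lemma element_load_comb:
  assumes "u \<in> fe_space M" "v \<in> fe_space M" "T \<in> M"
  shows "- d * (measure lebesgue T * (e \<bullet> average_grad T (\<lambda>x. u x + c * v x)))
    = - d * (measure lebesgue T * (e \<bullet> average_grad T u))
      + c * (- d * (measure lebesgue T * (e \<bullet> average_grad T v)))"
  using assms by (simp add: average_grad_comb inner_right_distrib algebra_simps)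

text \<open>Unique solvability gives the definite description its meaning; positivity of
  \<open>lin\<close> is the condition \<open>lout + d > 0\<close>.\<close>

lemma corrector_K_solves:
  assumes T: "T \<in> M" and conn: "connected (mesh_domain M)" and pos: "lout > 0" "lin > 0"
  shows "corrector_K M T lout lin e \<in> fe_space M \<and>
    (\<forall>\<psi>\<in>fe_space M. energy T lout (lin - lout) (corrector_K M T lout lin e) \<psi>
      = - (lin - lout) * (measure lebesgue T * (e \<bullet> average_grad T \<psi>)))"
proof -
  let ?P = "\<lambda>K. K \<in> fe_space M \<and> (\<forall>\<psi>\<in>fe_space M. energy T lout (lin - lout) K \<psi>
      = - (lin - lout) * (measure lebesgue T * (e \<bullet> average_grad T \<psi>)))"
  have "\<exists>!K. ?P K"
  proof (rule energy_ex1[OF T conn pos(1)])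
    show "0 < lout + (lin - lout)" using pos(2) by simp
  qed (rule element_load_comb[OF _ _ T])
  \<comment> \<open>Rewriting the integrals uses that both functions lie in the space, which
    \<open>conj_cong\<close> and \<open>ball_cong\<close> supply.\<close>
  moreover have "corrector_K M T lout lin e = (THE K. ?P K)"
    unfolding corrector_K_def
    by (intro arg_cong[where f = The] ext conj_cong ball_cong refl)
      (simp add: coeff_integral_eq_energy element_integral T)
  ultimately show ?thesis using theI'[of ?P] by simp
qed

lemma corrector_W_solves:
  assumes T: "T \<in> M" and conn: "connected (mesh_domain M)" and pos: "lout > 0"
  shows "corrector_W M T lout e \<in> fe_space M \<and>
    (\<forall>\<psi>\<in>fe_space M. lout * dirichlet (corrector_W M T lout e) \<psi>
      = - (measure lebesgue T * (e \<bullet> average_grad T \<psi>)))"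
proof -
  let ?P = "\<lambda>W. W \<in> fe_space M \<and> (\<forall>\<psi>\<in>fe_space M. lout * dirichlet W \<psi>
      = - (measure lebesgue T * (e \<bullet> average_grad T \<psi>)))"
  have "\<exists>!W. ?P W"
    using energy_ex1[OF T conn pos, of 0 "\<lambda>\<psi>. - 1 * (measure lebesgue T * (e \<bullet> average_grad T \<psi>))"]
      element_load_comb[OF _ _ T, of _ _ 1] pos by (simp add: energy_def)
  moreover have "corrector_W M T lout e = (THE W. ?P W)"
    unfolding corrector_W_def
    by (intro arg_cong[where f = The] ext conj_cong ball_cong refl)
      (simp add: dirichlet_def element_integral T)
  ultimately show ?thesis using theI'[of ?P] by simp
qed

text \<open>\<open>K\<close> solves the constant-coefficient problem with datum
  \<open>(lin - lout) * q\<close>, where \<open>q\<close> is \<open>e\<close> plus the gradient of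
  \<open>K\<close> on \<open>T\<close>. So does the matching combination of the \<open>W\<close>
  correctors, and uniqueness identifies the two.\<close>

lemma average_grad_corrector_K:
  assumes T: "T \<in> M" and conn: "connected (mesh_domain M)" and pos: "lout > 0" "lin > 0"
  shows "average_grad T (corrector_K M T lout lin e) =
    (lin - lout) *\<^sub>R (Gamma_matrix M T lout *v
      (e + average_grad T (corrector_K M T lout lin e)))"
proof -
  define K where "K = corrector_K M T lout lin e"
  define q where "q = e + average_grad T K"
  define d where "d = lin - lout"
  define W where "W k = corrector_W M T lout (axis k 1)" for k :: 2
  \<comment> \<open>The coefficients are the coordinates of the datum \<open>d * q\<close>. The
    leading 0 gives both sums the shape \<open>u x + c * v x\<close> of the combination
    lemmas.\<close>
  define U where "U = (\<lambda>x. (0 + (d * q $ 1) * W 1 x) + (d * q $ 2) * W 2 x)"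
  \<comment> \<open>The element term of the energy moves to the right, where it merges with
    \<open>e\<close> into \<open>q\<close>.\<close>
  have K: "K \<in> fe_space M" and K_eq: "\<And>\<psi>. \<psi> \<in> fe_space M \<Longrightarrow> lout * dirichlet K \<psi>
      = - d * (measure lebesgue T * (q \<bullet> average_grad T \<psi>))"
    using corrector_K_solves[OF T conn pos, of e]
    by (auto simp: K_def q_def d_def energy_def inner_left_distrib algebra_simps)
  have W: "W k \<in> fe_space M" and W_eq: "\<And>\<psi>. \<psi> \<in> fe_space M \<Longrightarrow> lout * dirichlet (W k) \<psi>
      = - (measure lebesgue T * average_grad T \<psi> $ k)" for k
    using corrector_W_solves[OF T conn pos(1), of "axis k 1"]
    by (auto simp: W_def inner_axis')
  have Z: "(\<lambda>x. 0 + (d * q $ 1) * W 1 x) \<in> fe_space M"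
    by (intro fe_space_comb fe_space_zero W)
  have U: "U \<in> fe_space M" unfolding U_def by (intro fe_space_comb Z W)
  have dirichlet_zero: "dirichlet (\<lambda>_. 0) \<psi> = 0" if "\<psi> \<in> fe_space M" for \<psi>
    using dirichlet_comb[OF fe_space_zero fe_space_zero that, of 1] by simp
  have average_zero: "average_grad T (\<lambda>_. 0) = 0"
    using average_grad_comb[OF fe_space_zero fe_space_zero T, of 1] by simp
  have "lout * dirichlet U \<psi> = lout * dirichlet K \<psi>" if \<psi>: "\<psi> \<in> fe_space M" for \<psi>
  proof -
    have "lout * dirichlet U \<psi> = d * q $ 1 * (lout * dirichlet (W 1) \<psi>)
        + d * q $ 2 * (lout * dirichlet (W 2) \<psi>)"
      unfolding U_def dirichlet_comb[OF Z W \<psi>] dirichlet_comb[OF fe_space_zero W \<psi>]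
        dirichlet_zero[OF \<psi>] by (simp add: algebra_simps)
    then show ?thesis
      unfolding W_eq[OF \<psi>] K_eq[OF \<psi>] by (simp add: inner_vec_def sum_2 algebra_simps)
  qed
  then have "energy T lout 0 U \<psi> = energy T lout 0 K \<psi>" if "\<psi> \<in> fe_space M" for \<psi>
    by (simp add: energy_def that)
  then have "U = K"
    by (intro energy_unique[OF T conn pos(1) _ U K, where d = 0]) (use pos in auto)
  have "average_grad T K = (d * q $ 1) *\<^sub>R average_grad T (W 1) + (d * q $ 2) *\<^sub>R average_grad T (W 2)"
    unfolding \<open>U = K\<close>[symmetric] unfolding U_def average_grad_comb[OF Z W T]
      average_grad_comb[OF fe_space_zero W T] average_zero by simp
  also have "\<dots> = d *\<^sub>R (Gamma_matrix M T lout *v q)"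
    by (simp add: vec_eq_iff matrix_vector_mult_def sum_2 Gamma_matrix_def W_def algebra_simps)
  finally show ?thesis by (simp add: K_def q_def d_def)
qed

end

section \<open>From the column identity to the matrix identities\<close>

theorem theorem6p1:
  fixes M :: "(real^2) set set" and T :: "(real^2) set" and lin lout :: real
  assumes "lin > 0" and "lout > 0"
    and "T = ref_triangle1 \<or> T = ref_triangle2"
    and "conforming_mesh M"
    and "connected (mesh_domain M)"
    and "T \<in> M"
    and "closure T \<subseteq> mesh_domain M"
  shows "invertible (mat 1 - (lin - lout) *\<^sub>R Gamma_matrix M T lout)
    \<and> P_matrix M T lout lin =
        ((lin - lout) *\<^sub>R Gamma_matrix M T lout)
          ** matrix_inv (mat 1 - (lin - lout) *\<^sub>R Gamma_matrix M T lout)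
    \<and> mat 1 + P_matrix M T lout lin =
        matrix_inv (mat 1 - (lin - lout) *\<^sub>R Gamma_matrix M T lout)"
proof -
  define G where "G = (lin - lout) *\<^sub>R Gamma_matrix M T lout"
  define P where "P = P_matrix M T lout lin"
  \<comment> \<open>Column \<open>k\<close> is the averaged gradient identity for the datum
    \<open>axis k 1\<close>, which is column \<open>k\<close> of the identity matrix.\<close>
  have P: "P = G ** (mat 1 + P)"
  proof -
    have "P $ i $ k = (G ** (mat 1 + P)) $ i $ k" for i k
    proof -
      have col: "(axis k 1 + average_grad T (corrector_K M T lout lin (axis k 1))) $ j
          = (mat 1 + P) $ j $ k" for j
        by (simp add: P_def P_matrix_def mat_def axis_def)
      have "P $ i $ k = average_grad T (corrector_K M T lout lin (axis k 1)) $ i"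
        by (simp add: P_def P_matrix_def)
      also have "\<dots> = (lin - lout) * (\<Sum>j\<in>UNIV. Gamma_matrix M T lout $ i $ j
          * (axis k 1 + average_grad T (corrector_K M T lout lin (axis k 1))) $ j)"
        by (subst average_grad_corrector_K[OF assms(4,6,5,2,1)])
          (simp add: matrix_vector_mult_def)
      also have "\<dots> = (G ** (mat 1 + P)) $ i $ k"
        unfolding col by (simp add: G_def matrix_matrix_mult_def sum_distrib_left mult.assoc)
      finally show ?thesis .
    qed
    then show ?thesis by (simp add: vec_eq_iff)
  qed
  have right: "(mat 1 - G) ** (mat 1 + P) = mat 1"
  proof -
    have diff: "(A - B) ** C = A ** C - B ** C" for A B C :: "real^2^2"
      by (simp add: matrix_matrix_mult_def vec_eq_iff left_diff_distrib sum_subtractf)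
    have "(mat 1 - G) ** (mat 1 + P) = (mat 1 + P) - G ** (mat 1 + P)"
      by (simp only: diff matrix_mul_lid)
    also have "\<dots> = mat 1" by (simp only: P[symmetric] add_diff_cancel_right')
    finally show ?thesis .
  qed
  \<comment> \<open>For square matrices a right inverse suffices. Invertibility also ensures that
    the choice term \<open>matrix_inv\<close> is a true inverse.\<close>
  then have inv: "invertible (mat 1 - G)" using invertible_right_inverse by blast
  then have left: "matrix_inv (mat 1 - G) ** (mat 1 - G) = mat 1"
    unfolding invertible_def matrix_inv_def by (rule someI2_ex) simp
  have "matrix_inv (mat 1 - G) = matrix_inv (mat 1 - G) ** ((mat 1 - G) ** (mat 1 + P))"
    using right by simp
  also have "\<dots> = mat 1 + P" by (simp only: matrix_mul_assoc left matrix_mul_lid)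
  finally have inverse: "matrix_inv (mat 1 - G) = mat 1 + P" .
  \<comment> \<open>With the inverse replaced by \<open>mat 1 + P\<close>, the product formula is
    the fixed-point equation \<open>P\<close> and the last identity is reflexive.\<close>
  show ?thesis
    unfolding G_def[symmetric] P_def[symmetric] inverse using inv P by blast
qed

end
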